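(* Let $w^0,w^1,w^2,\dots:\mathbb{I}\to[0,1]$ be weight functions, let $x^0\in\mathbb{R}^n$ be arbitrary, and let $x^{k+1}=\sum_{\iota\in\mathbb{I}}w^k(\iota)P[\iota](x^k)$ for all $k\ge 0$. Let $f_1,f_2,f_3,\dots\in[0,1]$ be numbers such that $\sum_{r=1}^\infty f_r=\infty$. Suppose there is an infinite strictly increasing sequence of iteration numbers (nonnegative integers) $\kappa_1<\kappa_2<\kappa_3<\dots$ such that both of the following are true: (C1) $\displaystyle\sum_{k=\kappa_r}^{\kappa_{r+1}-2}\mathrm{MaxLength}(w^k)\le\frac{1}{f_r}$ for all $r\in\mathbb{Z}^+$ such that $\kappa_{r+1}\ge\kappa_r+2$ and $f_r>0$. (C2) For every index $i$ such that $C_i\neq\mathbb{R}^n$, $\displaystyle\max_{\kappa_r\le k<\kappa_{r+1}}\sum_{\iota\in\mathbb{I}\langle i\rangle}\frac{w^k(\iota)}{\mathrm{Pos}(i,\iota)}\ge f_r$ for all sufficiently large $r\in\mathbb{Z}^+$. Then $x^0,x^1,x^2,\dots$ converges to a point in $\bigcap\mathcal{C}$.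
   Context: Fix a positive integer $n$ and an infinite sequence $C_1,C_2,C_3,\dots$ of closed convex subsets of $\mathbb{R}^n$ such that $\bigcap_{i=1}^\infty C_i\neq\emptyset$ and at least one $C_i$ is not $\mathbb{R}^n$. Write $\mathcal{C}=\{C_i\mid 1\le i<\infty\}$, so $\bigcap\mathcal{C}=\bigcap_{i=1}^\infty C_i$. An index is a positive integer. For each index $j$, $P_j:\mathbb{R}^n\to C_j$ maps each $q$ to the unique point of $C_j$ closest to $q$ in the Euclidean norm. $\mathbb{I}$ is the set of all nonempty finite sequences of indices (repetitions allowed); its members are called index vectors. For $\iota=(\iota_1,\dots,\iota_m)\in\mathbb{I}$, $P[\iota]=P_{\iota_m}\circ P_{\iota_{m-1}}\circ\dots\circ P_{\iota_1}$ and $\mathrm{Length}(\iota)=m$. For an index $i$, $\mathbb{I}\langle i\rangle$ is the set of index vectors in which $i$ occurs; for $\iota\in\mathbb{I}\langle i\rangle$, $\mathrm{Pos}(i,\iota)$ is the least $j$ with $\iota_j=i$. A weight function is a function $w:\mathbb{I}\to[0,1]$ with finite support such that $\sum_{\iota\in\mathbb{I}}w(\iota)=1$. For a weight function $w$, $\mathrm{MaxLength}(w)=\max\{\mathrm{Length}(\iota)\mid\iota\in\mathbb{I},\ w(\iota)>0\}$. *)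

theory Defs
  imports "HOL-Analysis.Analysis"
begin

text \<open>
  An index is a positive integer; a family of sets indexed by positive integers is a function
  on type \<^typ>\<open>nat\<close> whose value at \<open>0\<close> is never used.
\<close>

definition index_vectors :: "nat list set"
  where "index_vectors = {\<iota>. \<iota> \<noteq> [] \<and> set \<iota> \<subseteq> {1..}}"

definition index_vectors_with :: "nat \<Rightarrow> nat list set"
  where "index_vectors_with i = {\<iota> \<in> index_vectors. i \<in> set \<iota>}"

text \<open>
  Positions are counted from \<open>1\<close>, whereas list access \<open>\<iota> ! j\<close> counts from \<open>0\<close>.
\<close>

definition first_pos :: "nat \<Rightarrow> nat list \<Rightarrow> nat"
  where "first_pos i \<iota> = (LEAST j. 1 \<le> j \<and> j \<le> length \<iota> \<and> \<iota> ! (j - 1) = i)"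

text \<open>
  Since \<open>fold\<close> runs through the list from the left, the first entry of \<open>\<iota>\<close> is the projection
  that is applied first.
\<close>

definition iterated_projection ::
    "(nat \<Rightarrow> 'a::euclidean_space set) \<Rightarrow> nat list \<Rightarrow> 'a \<Rightarrow> 'a"
  where "iterated_projection C \<iota> = fold (\<lambda>i. closest_point (C i)) \<iota>"

text \<open>
  A function on index vectors is a function on all lists of naturals whose values off
  \<^const>\<open>index_vectors\<close> are ignored. Sums over infinite sets of index vectors are taken over the
  intersection with the finite support.
\<close>

definition weight_support :: "(nat list \<Rightarrow> real) \<Rightarrow> nat list set"
  where "weight_support w = {\<iota> \<in> index_vectors. w \<iota> \<noteq> 0}"

definition weight_function :: "(nat list \<Rightarrow> real) \<Rightarrow> bool"
  where "weight_function w \<longleftrightarrow>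
    (\<forall>\<iota>\<in>index_vectors. w \<iota> \<in> {0..1}) \<and>
    finite (weight_support w) \<and>
    (\<Sum>\<iota>\<in>weight_support w. w \<iota>) = 1"

definition max_length :: "(nat list \<Rightarrow> real) \<Rightarrow> nat"
  where "max_length w = Max {length \<iota> | \<iota>. \<iota> \<in> index_vectors \<and> w \<iota> > 0}"

end

theory Submission
  imports Defs
begin

text \<open>
  A projection onto a closed convex set containing \<open>p\<close> decreases the squared distance to \<open>p\<close> by at
  least the square of the distance moved (\<open>closest_point_firm\<close>). Summed along a string of projections
  and averaged over the strings, this says that one iteration decreases the squared distance to every
  common point of the \<open>C i\<close> by at least the \<^emph>\<open>energy\<close> \<open>E k\<close>, the average over the strings of
  the sum of the squared individual moves (\<open>averaged_pythagoras\<close>). Hence the \<open>E k\<close> have a finite sum, and the iterates are Fejer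
  monotone: their distance to every common point is nonincreasing.

  By the Cauchy-Schwarz inequality the energy controls two things. A string of length \<open>m\<close> moves a
  point by at most \<open>sqrt m\<close> times the square root of its squared path length, so an iteration moves
  \<open>x k\<close> by at most \<open>sqrt (max_length (w k) * E k)\<close> (\<open>averaged_displacement_le\<close>). A string in which
  \<open>i\<close> first occurs at position \<open>s\<close> visits \<open>C i\<close> after \<open>s\<close> moves, so the squared distance from \<open>x k\<close> to
  \<open>C i\<close>, weighted by \<open>w \<iota> / s\<close> and summed over these strings, is at most \<open>E k\<close> (\<open>covered_infdist_le\<close>).

  Now consider the block of iterations from \<open>\<kappa> r\<close> up to \<open>\<kappa> (r + 1)\<close>. Given a proper
  subset \<open>C i\<close> and a large \<open>r\<close>, for some \<open>k\<close> in the block those weights \<open>w \<iota> / s\<close> add up to at least \<open>f r\<close>,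
  so \<open>x k\<close> is close to \<open>C i\<close> relative to \<open>1 / f r\<close> and the energy; the length bound says that \<open>x (\<kappa> r)\<close>
  is close to \<open>x k\<close> in the same sense. Together, \<open>f r\<close> times the squared distance from \<open>x (\<kappa> r)\<close> to \<open>C i\<close> is at most twice
  the energy of the block. The starting point \<open>x (\<kappa> r)\<close> does not depend on \<open>i\<close>, although \<open>k\<close> does; so
  this can be added up over finitely many \<open>i\<close>. The block energies have a finite sum and the \<open>f r\<close> do not,
  so for each \<open>N\<close> there is an \<open>r\<close> with \<open>x (\<kappa> r)\<close> close to \<open>C 1\<close>, ..., \<open>C N\<close> at once
  (\<open>frequently_small_if_weighted_sums_bounded\<close>). Letting \<open>N\<close> grow gives a sequence of iterates all
  of whose cluster points lie in every \<open>C i\<close>, and Fejer monotonicity turns one such cluster point into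
  the limit of the whole sequence (\<open>fejer_monotone_convergent\<close>).
\<close>

section \<open>Quadratic inequalities\<close>

text \<open>
  This two-term Cauchy-Schwarz inequality is the induction step for all bounds of a squared path by a
  number of steps times a sum of squares. It avoids square roots and is valid when \<open>M\<close> or \<open>N\<close> is \<open>0\<close>.
\<close>

lemma squared_add_le:
  fixes a b :: real
  assumes "a\<^sup>2 \<le> M * S" "b\<^sup>2 \<le> N * T" "0 \<le> M" "0 \<le> S" "0 \<le> N" "0 \<le> T"
  shows "(a + b)\<^sup>2 \<le> (M + N) * (S + T)"
proof -
  have "(2 * (a * b))\<^sup>2 = 4 * (a\<^sup>2 * b\<^sup>2)"
    by (simp add: power_mult_distrib)
  also have "\<dots> \<le> 4 * ((M * S) * (N * T))"
    using assms by (intro mult_left_mono mult_mono) auto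
  \<comment> \<open>The arithmetic-geometric mean inequality for \<open>M * T\<close> and \<open>N * S\<close>.\<close>
  also have "\<dots> = (M * T + N * S)\<^sup>2 - (M * T - N * S)\<^sup>2"
    by (simp add: power2_eq_square algebra_simps)
  also have "\<dots> \<le> (M * T + N * S)\<^sup>2"
    by simp
  finally have "2 * (a * b) \<le> M * T + N * S"
    by (rule power2_le_imp_le) (use assms in simp)
  then show ?thesis
    using assms(1,2) by (simp add: power2_eq_square algebra_simps)
qed

lemma norm_convex_combination_squared_le:
  fixes v :: "'b \<Rightarrow> 'a::real_normed_vector"
  assumes "finite A" and nonneg: "\<And>a. a \<in> A \<Longrightarrow> 0 \<le> u a" and one: "sum u A = 1"
  shows "(norm (\<Sum>a\<in>A. u a *\<^sub>R v a))\<^sup>2 \<le> (\<Sum>a\<in>A. u a * (norm (v a))\<^sup>2)"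
proof -
  have "norm (\<Sum>a\<in>A. u a *\<^sub>R v a) \<le> (\<Sum>a\<in>A. u a * norm (v a))"
    by (rule order_trans[OF norm_sum]) (simp add: nonneg)
  then have "(norm (\<Sum>a\<in>A. u a *\<^sub>R v a))\<^sup>2 \<le> (\<Sum>a\<in>A. u a * norm (v a))\<^sup>2"
    by (simp add: power_mono)
  also have "\<dots> \<le> (\<Sum>a\<in>A. u a * (norm (v a))\<^sup>2)"
  proof -
    have "A \<noteq> {}" using one by auto
    from convex_on_sum[OF \<open>finite A\<close> this convex_power2 one, of "\<lambda>a. norm (v a)"]
    show ?thesis using nonneg by simp
  qed
  finally show ?thesis .
qed

section \<open>Strings of projections\<close>

text \<open>
  The angle at the projection \<open>z\<close> between \<open>q - z\<close> and \<open>p - z\<close> is not acute, so the law of cosines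
  makes Pythagoras' equation an inequality in this direction.
\<close>

lemma closest_point_firm:
  fixes q p :: "'a::euclidean_space"
  assumes "closed S" "convex S" "p \<in> S"
  shows "(dist (closest_point S q) p)\<^sup>2 + (dist q (closest_point S q))\<^sup>2 \<le> (dist q p)\<^sup>2"
proof -
  let ?z = "closest_point S q"
  have "inner (q - ?z) (p - ?z) \<le> 0"
    using assms by (intro closest_point_dot)
  moreover have "(dist q p)\<^sup>2
      = (dist ?z p)\<^sup>2 + (dist q ?z)\<^sup>2 - 2 * inner (q - ?z) (p - ?z)"
    by (simp add: dist_norm power2_norm_eq_inner inner_diff_left inner_diff_right inner_commute)
  ultimately show ?thesis by linarith
qed

primrec squared_path_length ::
    "(nat \<Rightarrow> 'a::euclidean_space set) \<Rightarrow> nat list \<Rightarrow> 'a \<Rightarrow> real"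
  where
    "squared_path_length C [] q = 0"
  | "squared_path_length C (i # \<iota>) q =
       (dist q (closest_point (C i) q))\<^sup>2 + squared_path_length C \<iota> (closest_point (C i) q)"

lemma squared_path_length_nonneg: "0 \<le> squared_path_length C \<iota> q"
  by (induction \<iota> arbitrary: q) simp_all

lemma iterated_projection_Nil [simp]: "iterated_projection C [] q = q"
  and iterated_projection_Cons [simp]:
    "iterated_projection C (i # \<iota>) q = iterated_projection C \<iota> (closest_point (C i) q)"
  by (simp_all add: iterated_projection_def)

lemma iterated_projection_append:
  "iterated_projection C (\<iota> @ \<iota>') q = iterated_projection C \<iota>' (iterated_projection C \<iota> q)"
  by (simp add: iterated_projection_def)

lemma squared_path_length_append:
  "squared_path_length C (\<iota> @ \<iota>') q =
     squared_path_length C \<iota> q + squared_path_length C \<iota>' (iterated_projection C \<iota> q)"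
  by (induction \<iota> arbitrary: q) simp_all

text \<open>
  The gains of the single projections telescope, since \<open>p\<close> lies in all the sets that are visited.
\<close>

lemma iterated_projection_pythagoras:
  assumes "\<And>i. i \<in> set \<iota> \<Longrightarrow> closed (C i) \<and> convex (C i) \<and> p \<in> C i"
  shows "(dist (iterated_projection C \<iota> q) p)\<^sup>2 + squared_path_length C \<iota> q \<le> (dist q p)\<^sup>2"
  using assms
proof (induction \<iota> arbitrary: q)
  case (Cons i \<iota>)
  let ?z = "closest_point (C i) q"
  have "(dist (iterated_projection C \<iota> ?z) p)\<^sup>2 + squared_path_length C \<iota> ?z \<le> (dist ?z p)\<^sup>2"
    using Cons by simp
  moreover have "(dist ?z p)\<^sup>2 + (dist q ?z)\<^sup>2 \<le> (dist q p)\<^sup>2"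
    using Cons.prems by (simp add: closest_point_firm)
  ultimately show ?case by simp
qed simp

lemma squared_displacement_le:
  "(dist q (iterated_projection C \<iota> q))\<^sup>2 \<le> real (length \<iota>) * squared_path_length C \<iota> q"
proof (induction \<iota> arbitrary: q)
  case (Cons i \<iota>)
  let ?z = "closest_point (C i) q"
  have "(dist q (iterated_projection C \<iota> ?z))\<^sup>2
      \<le> (dist q ?z + dist ?z (iterated_projection C \<iota> ?z))\<^sup>2"
    by (intro power_mono dist_triangle zero_le_dist)
  also have "\<dots> \<le> (1 + real (length \<iota>)) * ((dist q ?z)\<^sup>2 + squared_path_length C \<iota> ?z)"
    using Cons.IH by (intro squared_add_le) (auto simp: squared_path_length_nonneg)
  finally show ?case by (simp add: add.commute)
qed simp

lemma first_pos_properties: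
  assumes "i \<in> set \<iota>"
  shows "1 \<le> first_pos i \<iota>" "first_pos i \<iota> \<le> length \<iota>" "\<iota> ! (first_pos i \<iota> - 1) = i"
proof -
  obtain j where "j < length \<iota>" "\<iota> ! j = i"
    using assms by (auto simp: in_set_conv_nth)
  then have "1 \<le> Suc j \<and> Suc j \<le> length \<iota> \<and> \<iota> ! (Suc j - 1) = i" by simp
  from LeastI[where P = "\<lambda>j. 1 \<le> j \<and> j \<le> length \<iota> \<and> \<iota> ! (j - 1) = i", OF this]
  show "1 \<le> first_pos i \<iota>" "first_pos i \<iota> \<le> length \<iota>" "\<iota> ! (first_pos i \<iota> - 1) = i"
    unfolding first_pos_def by auto
qed

text \<open>
  The prefix of the string that ends with the first occurrence of \<open>i\<close> leads from \<open>q\<close> to a point of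
  \<open>C i\<close>, so only the displacement along that prefix matters. This is why the bound has the position
  of \<open>i\<close> as its factor and not the length of the whole string.
\<close>

lemma squared_infdist_le_first_pos:
  assumes i: "i \<in> set \<iota>" and "closed (C i)" "C i \<noteq> {}"
  shows "(infdist q (C i))\<^sup>2 \<le> real (first_pos i \<iota>) * squared_path_length C \<iota> q"
proof -
  define s where "s = first_pos i \<iota> - 1"
  have s: "first_pos i \<iota> = Suc s" "s < length \<iota>" "\<iota> ! s = i"
    using first_pos_properties[OF i] by (auto simp: s_def)
  have upto: "take (Suc s) \<iota> = take s \<iota> @ [i]"
    using s by (simp add: take_Suc_conv_app_nth)
  have "iterated_projection C (take (Suc s) \<iota>) q \<in> C i"
    unfolding upto using assms by (simp add: iterated_projection_append closest_point_in_set)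
  then have "(infdist q (C i))\<^sup>2 \<le> (dist q (iterated_projection C (take (Suc s) \<iota>) q))\<^sup>2"
    by (intro power_mono infdist_le infdist_nonneg)
  also have "\<dots> \<le> real (length (take (Suc s) \<iota>)) * squared_path_length C (take (Suc s) \<iota>) q"
    by (rule squared_displacement_le)
  also have "\<dots> = real (first_pos i \<iota>) * squared_path_length C (take (Suc s) \<iota>) q"
    using s by simp
  also have "\<dots> \<le> real (first_pos i \<iota>) * squared_path_length C \<iota> q"
    using squared_path_length_append[of C "take (Suc s) \<iota>" "drop (Suc s) \<iota>" q]
    by (intro mult_left_mono) (simp_all add: squared_path_length_nonneg)
  finally show ?thesis .
qed

section \<open>One averaged iteration\<close>

text \<open>
  By \<open>averaged_pythagoras\<close>, this is a lower bound for the decrease of the squared distance to a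
  common point in one averaged iteration.
\<close>

definition step_energy ::
    "(nat \<Rightarrow> 'a::euclidean_space set) \<Rightarrow> (nat list \<Rightarrow> real) \<Rightarrow> 'a \<Rightarrow> real"
  where "step_energy C w q = (\<Sum>\<iota>\<in>weight_support w. w \<iota> * squared_path_length C \<iota> q)"

lemma weight_functionD:
  assumes "weight_function w"
  shows "finite (weight_support w)" "(\<Sum>\<iota>\<in>weight_support w. w \<iota>) = 1"
    and "\<And>\<iota>. \<iota> \<in> weight_support w \<Longrightarrow> 0 < w \<iota>"
    and "\<And>\<iota>. \<iota> \<in> weight_support w \<Longrightarrow> \<iota> \<in> index_vectors"
  using assms unfolding weight_function_def
  by (auto simp: weight_support_def order_less_le)

lemma step_energy_nonneg: "weight_function w \<Longrightarrow> 0 \<le> step_energy C w q"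
  unfolding step_energy_def
  by (intro sum_nonneg mult_nonneg_nonneg)
    (auto simp: squared_path_length_nonneg less_imp_le dest: weight_functionD)

lemma length_le_max_length:
  assumes w: "weight_function w" and "\<iota> \<in> weight_support w"
  shows "length \<iota> \<le> max_length w"
proof -
  have "\<iota> \<in> index_vectors \<and> w \<iota> > 0 \<longleftrightarrow> \<iota> \<in> weight_support w" for \<iota>
    using weight_functionD(3)[OF w, of \<iota>] unfolding weight_support_def by auto
  then have eq: "{length \<iota> | \<iota>. \<iota> \<in> index_vectors \<and> w \<iota> > 0} = length ` weight_support w"
    by (simp add: Setcompr_eq_image)
  show ?thesis
    unfolding max_length_def eq
    using assms weight_functionD(1)[OF w] by (intro Max_ge) auto
qed

text \<open>
  The squared distance to \<open>p\<close> is convex, so that of the average is at most the average of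
  the squared distances, to which \<open>iterated_projection_pythagoras\<close> applies.
\<close>

lemma averaged_pythagoras:
  assumes w: "weight_function w"
    and C: "\<And>i. i \<ge> 1 \<Longrightarrow> closed (C i) \<and> convex (C i) \<and> p \<in> C i"
  shows "(dist (\<Sum>\<iota>\<in>weight_support w. w \<iota> *\<^sub>R iterated_projection C \<iota> q) p)\<^sup>2 + step_energy C w q
      \<le> (dist q p)\<^sup>2"
proof -
  note W = weight_functionD[OF w]
  have "(\<Sum>\<iota>\<in>weight_support w. w \<iota> *\<^sub>R iterated_projection C \<iota> q) - p
      = (\<Sum>\<iota>\<in>weight_support w. w \<iota> *\<^sub>R (iterated_projection C \<iota> q - p))"
    by (simp add: scaleR_diff_right sum_subtractf W(2) flip: scaleR_left.sum)
  then have "(dist (\<Sum>\<iota>\<in>weight_support w. w \<iota> *\<^sub>R iterated_projection C \<iota> q) p)\<^sup>2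
      \<le> (\<Sum>\<iota>\<in>weight_support w. w \<iota> * (dist (iterated_projection C \<iota> q) p)\<^sup>2)"
    unfolding dist_norm using W
    by (simp add: norm_convex_combination_squared_le less_imp_le)
  also have "\<dots> + step_energy C w q
      = (\<Sum>\<iota>\<in>weight_support w. w \<iota> *
          ((dist (iterated_projection C \<iota> q) p)\<^sup>2 + squared_path_length C \<iota> q))"
    by (simp add: step_energy_def sum.distrib distrib_left)
  also have "\<dots> \<le> (\<Sum>\<iota>\<in>weight_support w. w \<iota> * (dist q p)\<^sup>2)"
  proof (intro sum_mono mult_left_mono iterated_projection_pythagoras)
    fix \<iota> i assume "\<iota> \<in> weight_support w" "i \<in> set \<iota>"
    then show "closed (C i) \<and> convex (C i) \<and> p \<in> C i"
      using C W(4)[of \<iota>] by (auto simp: index_vectors_def)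
  qed (use W in \<open>auto simp: less_imp_le\<close>)
  also have "\<dots> = (dist q p)\<^sup>2"
    by (simp add: W(2) flip: sum_distrib_right)
  finally show ?thesis by simp
qed

lemma averaged_displacement_le:
  assumes w: "weight_function w"
  shows "(dist q (\<Sum>\<iota>\<in>weight_support w. w \<iota> *\<^sub>R iterated_projection C \<iota> q))\<^sup>2
      \<le> real (max_length w) * step_energy C w q"
proof -
  note W = weight_functionD[OF w]
  have "(\<Sum>\<iota>\<in>weight_support w. w \<iota> *\<^sub>R iterated_projection C \<iota> q) - q
      = (\<Sum>\<iota>\<in>weight_support w. w \<iota> *\<^sub>R (iterated_projection C \<iota> q - q))"
    by (simp add: scaleR_diff_right sum_subtractf W(2) flip: scaleR_left.sum)
  then have "(dist q (\<Sum>\<iota>\<in>weight_support w. w \<iota> *\<^sub>R iterated_projection C \<iota> q))\<^sup>2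
      \<le> (\<Sum>\<iota>\<in>weight_support w. w \<iota> * (dist q (iterated_projection C \<iota> q))\<^sup>2)"
    unfolding dist_commute[of q] unfolding dist_norm using W
    by (simp add: norm_convex_combination_squared_le less_imp_le)
  also have "\<dots> \<le> (\<Sum>\<iota>\<in>weight_support w. w \<iota> * (real (max_length w) * squared_path_length C \<iota> q))"
  proof (intro sum_mono mult_left_mono)
    fix \<iota> assume \<iota>: "\<iota> \<in> weight_support w"
    show "(dist q (iterated_projection C \<iota> q))\<^sup>2 \<le> real (max_length w) * squared_path_length C \<iota> q"
      using squared_displacement_le[of q C \<iota>] length_le_max_length[OF w \<iota>]
      by (meson mult_right_mono of_nat_mono order_trans squared_path_length_nonneg)
  qed (use W in \<open>auto simp: less_imp_le\<close>)
  also have "\<dots> = real (max_length w) * step_energy C w q"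
    by (simp add: step_energy_def sum_distrib_left mult_ac)
  finally show ?thesis .
qed

text \<open>
  Each string through \<open>i\<close> contributes \<open>squared_infdist_le_first_pos\<close>, divided by the position of
  \<open>i\<close>; the strings that avoid \<open>i\<close> only add nonnegative energy.
\<close>

lemma covered_infdist_le:
  assumes w: "weight_function w" and "closed (C i)" "C i \<noteq> {}"
  shows "(\<Sum>\<iota>\<in>weight_support w \<inter> index_vectors_with i. w \<iota> / real (first_pos i \<iota>))
          * (infdist q (C i))\<^sup>2 \<le> step_energy C w q"
proof -
  note W = weight_functionD[OF w]
  let ?A = "weight_support w \<inter> index_vectors_with i"
  have "(\<Sum>\<iota>\<in>?A. w \<iota> / real (first_pos i \<iota>)) * (infdist q (C i))\<^sup>2
      = (\<Sum>\<iota>\<in>?A. w \<iota> / real (first_pos i \<iota>) * (infdist q (C i))\<^sup>2)"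
    by (simp only: sum_distrib_right)
  also have "\<dots> \<le> (\<Sum>\<iota>\<in>?A. w \<iota> * squared_path_length C \<iota> q)"
  proof (rule sum_mono)
    fix \<iota> assume "\<iota> \<in> ?A"
    then have pos: "0 < w \<iota>" and i: "i \<in> set \<iota>"
      using W by (auto simp: index_vectors_with_def)
    have "(infdist q (C i))\<^sup>2 / real (first_pos i \<iota>) \<le> squared_path_length C \<iota> q"
      using squared_infdist_le_first_pos[OF i, of C q] assms(2,3) first_pos_properties(1)[OF i]
      by (simp add: divide_le_eq mult.commute)
    from mult_left_mono[OF this less_imp_le[OF pos]]
    show "w \<iota> / real (first_pos i \<iota>) * (infdist q (C i))\<^sup>2
        \<le> w \<iota> * squared_path_length C \<iota> q"
      by simp
  qed
  also have "\<dots> \<le> step_energy C w q"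
    unfolding step_energy_def using W
    by (intro sum_mono2) (auto simp: squared_path_length_nonneg less_imp_le)
  finally show ?thesis .
qed

section \<open>Divergent weights and Fejer monotone sequences\<close>

lemma squared_path_dist_le:
  fixes x :: "nat \<Rightarrow> 'a::metric_space"
  assumes step: "\<And>k. (dist (x k) (x (Suc k)))\<^sup>2 \<le> M k * E k"
    and M: "\<And>k. 0 \<le> M k" and E: "\<And>k. 0 \<le> E k" and "a \<le> b"
  shows "(dist (x a) (x b))\<^sup>2 \<le> sum M {a..<b} * sum E {a..<b}"
  using \<open>a \<le> b\<close>
proof (induction b rule: dec_induct)
  case (step b)
  have "(dist (x a) (x (Suc b)))\<^sup>2 \<le> (dist (x a) (x b) + dist (x b) (x (Suc b)))\<^sup>2"
    by (intro power_mono dist_triangle zero_le_dist)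
  also have "\<dots> \<le> (sum M {a..<b} + M b) * (sum E {a..<b} + E b)"
    using step assms(1-3) by (intro squared_add_le sum_nonneg) auto
  finally show ?case using step by simp
qed simp

text \<open>
  If \<open>g r \<ge> \<epsilon>\<close> for all \<open>r > N\<close>, then eventually \<open>f r \<le> h r / \<epsilon>\<close>, so the partial sums of \<open>f\<close> would
  be bounded.
\<close>

lemma frequently_small_if_weighted_sums_bounded:
  fixes f g h :: "nat \<Rightarrow> real"
  assumes div: "filterlim (\<lambda>N. \<Sum>r=1..N. f r) at_top sequentially"
    and f: "\<And>r. r \<ge> 1 \<Longrightarrow> 0 \<le> f r"
    and h: "\<And>r. r \<ge> 1 \<Longrightarrow> 0 \<le> h r" and bd: "\<And>N. (\<Sum>r=1..N. h r) \<le> B"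
    and ev: "\<forall>\<^sub>F r in sequentially. f r * g r \<le> h r"
    and "\<epsilon> > 0"
  shows "\<exists>r>N. g r < \<epsilon>"
proof (rule ccontr)
  assume "\<not> ?thesis"
  then have large: "\<epsilon> \<le> g r" if "r > N" for r using that by force
  obtain R0 where R0: "\<And>r. r \<ge> R0 \<Longrightarrow> f r * g r \<le> h r"
    using ev by (auto simp: eventually_sequentially)
  define R where "R = Suc (max N R0)"
  have tail: "f r \<le> h r / \<epsilon>" if "r \<ge> R" for r
  proof -
    have "f r * \<epsilon> \<le> f r * g r"
      using that f[of r] by (intro mult_left_mono large) (auto simp: R_def)
    also have "\<dots> \<le> h r" using that by (intro R0) (auto simp: R_def)
    finally show ?thesis using \<open>\<epsilon> > 0\<close> by (simp add: pos_le_divide_eq)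
  qed
  have "(\<Sum>r=1..n. f r) \<le> (\<Sum>r=1..R. f r) + B / \<epsilon>" for n
  proof -
    have "(\<Sum>r=1..n. f r) \<le> (\<Sum>r\<in>{1..R} \<union> {Suc R..n}. f r)"
      using f by (intro sum_mono2) auto
    also have "\<dots> = (\<Sum>r=1..R. f r) + (\<Sum>r=Suc R..n. f r)"
      by (intro sum.union_disjoint) auto
    also have "(\<Sum>r=Suc R..n. f r) \<le> (\<Sum>r=Suc R..n. h r / \<epsilon>)"
      by (intro sum_mono tail) auto
    also have "\<dots> \<le> (\<Sum>r=1..n. h r / \<epsilon>)"
      using h \<open>\<epsilon> > 0\<close> by (intro sum_mono2) auto
    also have "\<dots> \<le> B / \<epsilon>"
      using bd[of n] \<open>\<epsilon> > 0\<close> by (simp add: divide_right_mono flip: sum_divide_distrib)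
    finally show ?thesis by simp
  qed
  moreover have "\<forall>\<^sub>F n in sequentially. (\<Sum>r=1..R. f r) + B / \<epsilon> < (\<Sum>r=1..n. f r)"
    using div by (simp add: filterlim_at_top_dense)
  ultimately show False
    by (metis (no_types, lifting) eventually_False_sequentially eventually_mono not_less)
qed

text \<open>
  The iterates are bounded, so the subsequence along \<open>\<sigma>\<close> has a cluster point \<open>p\<close>. Since \<open>p\<close> is in \<open>S\<close>,
  the distance to \<open>p\<close> is nonincreasing along the full sequence, and it gets arbitrarily small once it
  does so along a subsequence.
\<close>

lemma fejer_monotone_convergent:
  fixes x :: "nat \<Rightarrow> 'a::euclidean_space"
  assumes fejer: "\<And>p k. p \<in> S \<Longrightarrow> dist (x (Suc k)) p \<le> dist (x k) p"
    and "S \<noteq> {}"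
    and cluster: "\<And>s p. strict_mono (s :: nat \<Rightarrow> nat) \<Longrightarrow> (x \<circ> (\<sigma> \<circ> s)) \<longlonglongrightarrow> p \<Longrightarrow> p \<in> S"
  shows "\<exists>p\<in>S. x \<longlonglongrightarrow> p"
proof -
  have mono: "dist (x n) p \<le> dist (x m) p" if "p \<in> S" "m \<le> n" for p m n
    using lift_Suc_antimono_le[of "\<lambda>k. dist (x k) p", OF fejer] that by blast
  obtain p0 where p0: "p0 \<in> S" using \<open>S \<noteq> {}\<close> by blast
  have "compact (cball p0 (dist (x 0) p0))" by simp
  moreover have "\<forall>n. (x \<circ> \<sigma>) n \<in> cball p0 (dist (x 0) p0)"
    using mono[OF p0, of 0] by (simp add: dist_commute)
  ultimately obtain p s where s: "strict_mono s" and lim: "((x \<circ> \<sigma>) \<circ> s) \<longlonglongrightarrow> p"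
    unfolding compact_def by metis
  have lim': "(x \<circ> (\<sigma> \<circ> s)) \<longlonglongrightarrow> p" using lim by (simp add: comp_assoc)
  have p: "p \<in> S" using cluster[OF s lim'] .
  have "x \<longlonglongrightarrow> p"
  proof (rule metric_LIMSEQ_I)
    fix \<epsilon> :: real assume "\<epsilon> > 0"
    then obtain m where m: "dist (x (\<sigma> (s m))) p < \<epsilon>"
      using metric_LIMSEQ_D[OF lim'] by (metis comp_apply order_refl)
    then show "\<exists>N. \<forall>n\<ge>N. dist (x n) p < \<epsilon>"
      using mono[OF p] by (meson le_less_trans)
  qed
  with p show ?thesis by blast
qed

section \<open>Convergence of the iteration\<close>

theorem theorem3p1:
  fixes C :: "nat \<Rightarrow> (real ^ 'n) set"
    and w :: "nat \<Rightarrow> nat list \<Rightarrow> real"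
    and x :: "nat \<Rightarrow> real ^ 'n"
    and f :: "nat \<Rightarrow> real"
    and \<kappa> :: "nat \<Rightarrow> nat"
  assumes closed_C: "\<And>i. i \<ge> 1 \<Longrightarrow> closed (C i)"
    and convex_C: "\<And>i. i \<ge> 1 \<Longrightarrow> convex (C i)"
    and Inter_C: "(\<Inter>i\<in>{1..}. C i) \<noteq> {}"
    and proper_C: "\<exists>i\<ge>1. C i \<noteq> UNIV"
    and weights: "\<And>k. weight_function (w k)"
    and iteration: "\<And>k. x (Suc k) =
          (\<Sum>\<iota>\<in>weight_support (w k). w k \<iota> *\<^sub>R iterated_projection C \<iota> (x k))"
    and f_range: "\<And>r. r \<ge> 1 \<Longrightarrow> f r \<in> {0..1}"
    and f_diverges: "filterlim (\<lambda>N. \<Sum>r=1..N. f r) at_top sequentially"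
    and \<kappa>_strict: "strict_mono_on {1..} \<kappa>"
    and C1: "\<And>r. r \<ge> 1 \<Longrightarrow> \<kappa> (r + 1) \<ge> \<kappa> r + 2 \<Longrightarrow> f r > 0 \<Longrightarrow>
          real (\<Sum>k=\<kappa> r..\<kappa> (r + 1) - 2. max_length (w k)) \<le> 1 / f r"
    and C2: "\<And>i. i \<ge> 1 \<Longrightarrow> C i \<noteq> UNIV \<Longrightarrow>
          \<forall>\<^sub>F r in sequentially.
            (MAX k\<in>{\<kappa> r..<\<kappa> (r + 1)}.
               \<Sum>\<iota>\<in>weight_support (w k) \<inter> index_vectors_with i.
                 w k \<iota> / real (first_pos i \<iota>)) \<ge> f r"
  shows "\<exists>p\<in>(\<Inter>i\<in>{1..}. C i). x \<longlonglongrightarrow> p"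
proof -
  define E where "E k = step_energy C (w k) (x k)" for k
  define block where "block r = (\<Sum>k=\<kappa> r..<\<kappa> (r + 1). E k)" for r
  have E: "0 \<le> E k" for k
    by (simp add: E_def step_energy_nonneg weights)
  have nonempty: "C i \<noteq> {}" if "i \<ge> 1" for i
    using Inter_C that by auto
  have pythagoras: "(dist (x (Suc k)) p)\<^sup>2 + E k \<le> (dist (x k) p)\<^sup>2"
    if "p \<in> (\<Inter>i\<in>{1..}. C i)" for p k
    unfolding E_def iteration using that
    by (intro averaged_pythagoras weights) (auto simp: closed_C convex_C)
  have jump: "(dist (x k) (x (Suc k)))\<^sup>2 \<le> real (max_length (w k)) * E k" for k
    unfolding E_def iteration by (intro averaged_displacement_le weights)

  obtain p0 where p0: "p0 \<in> (\<Inter>i\<in>{1..}. C i)" using Inter_C by blast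
  define B where "B = (dist (x 0) p0)\<^sup>2"
  have E_bounded: "sum E {..<n} \<le> B" for n
  proof -
    have "(dist (x n) p0)\<^sup>2 + sum E {..<n} \<le> B"
    proof (induction n)
      case (Suc n)
      then show ?case using pythagoras[OF p0, of n] by simp
    qed (simp add: B_def)
    then show ?thesis using zero_le_power2[of "dist (x n) p0"] by linarith
  qed
  have \<kappa>_mono: "\<kappa> r < \<kappa> (Suc r)" if "r \<ge> 1" for r
    using \<kappa>_strict that by (simp add: strict_mono_on_def)
  have block_sum: "(\<Sum>r=1..N. block r) = sum E {\<kappa> 1..<\<kappa> (Suc N)}" for N
  proof (induction N)
    case (Suc N)
    have "\<kappa> 1 \<le> \<kappa> (Suc N)"
      using \<kappa>_strict by (simp add: strict_mono_on_leD)
    then show ?case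
      using Suc \<kappa>_mono[of "Suc N"]
      by (simp add: block_def sum.atLeastLessThan_concat)
  qed simp
  have block_bounded: "(\<Sum>r=1..N. block r) \<le> B" for N
    unfolding block_sum
    by (rule order_trans[OF _ E_bounded[of "\<kappa> (Suc N)"]]) (intro sum_mono2, auto simp: E)

  have block_estimate: "\<forall>\<^sub>F r in sequentially. f r * (infdist (x (\<kappa> r)) (C i))\<^sup>2 \<le> 2 * block r"
    if i: "i \<ge> 1" for i
  proof (cases "C i = UNIV")
    case True
    then show ?thesis by (simp add: block_def sum_nonneg E)
  next
    case False
    from C2[OF i False] eventually_ge_at_top[of 1] show ?thesis
    proof eventually_elim
      case (elim r)
      let ?cov = "\<lambda>k. \<Sum>\<iota>\<in>weight_support (w k) \<inter> index_vectors_with i.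
                 w k \<iota> / real (first_pos i \<iota>)"
      have "(MAX k\<in>{\<kappa> r..<\<kappa> (r + 1)}. ?cov k) \<in> ?cov ` {\<kappa> r..<\<kappa> (r + 1)}"
        using \<kappa>_mono[of r] elim by (intro Max_in) auto
      then obtain k where k: "\<kappa> r \<le> k" "k < \<kappa> (r + 1)" and cov: "f r \<le> ?cov k"
        using elim(1) by auto
      show ?case
      proof (cases "f r = 0")
        case True
        then show ?thesis by (simp add: block_def sum_nonneg E)
      next
        case False
        then have pos: "f r > 0" using f_range[of r] elim(2) by auto
        let ?M = "\<Sum>j=\<kappa> r..<k. real (max_length (w j))"
        \<comment> \<open>If \<open>k > \<kappa> r\<close>, the last summand has index \<open>k - 1 \<le> \<kappa> (r + 1) - 2\<close>, which is where the length
          bound ends. If \<open>k = \<kappa> r\<close>, the sum is empty; the block may then be a single iteration.\<close>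
        have M: "?M \<le> 1 / f r"
        proof (cases "k = \<kappa> r")
          case False
          then have two: "\<kappa> (r + 1) \<ge> \<kappa> r + 2" using k by simp
          have "?M \<le> real (\<Sum>j=\<kappa> r..\<kappa> (r + 1) - 2. max_length (w j))"
            unfolding of_nat_sum using k by (intro sum_mono2) auto
          also have "\<dots> \<le> 1 / f r" using C1 elim(2) two pos by blast
          finally show ?thesis .
        qed (use pos in simp)
        have before: "(dist (x (\<kappa> r)) (x k))\<^sup>2 \<le> 1 / f r * sum E {\<kappa> r..<k}"
          using squared_path_dist_le[of x "\<lambda>k. real (max_length (w k))" E, OF jump _ E k(1)] M
          by (meson E mult_right_mono of_nat_0_le_iff order_trans sum_nonneg)
        have "f r * (infdist (x k) (C i))\<^sup>2 \<le> ?cov k * (infdist (x k) (C i))\<^sup>2"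
          using cov by (simp add: mult_right_mono)
        also have "\<dots> \<le> E k"
          unfolding E_def using i by (intro covered_infdist_le weights closed_C nonempty)
        finally have at: "(infdist (x k) (C i))\<^sup>2 \<le> 1 / f r * E k"
          using pos by (simp add: pos_le_divide_eq mult.commute)
        have "(infdist (x (\<kappa> r)) (C i))\<^sup>2 \<le> (dist (x (\<kappa> r)) (x k) + infdist (x k) (C i))\<^sup>2"
          using infdist_triangle[of "x (\<kappa> r)" "C i" "x k"]
          by (intro power_mono infdist_nonneg) simp
        also have "\<dots> \<le> (1 / f r + 1 / f r) * (sum E {\<kappa> r..<k} + E k)"
          using before at pos E by (intro squared_add_le sum_nonneg) auto
        also have "sum E {\<kappa> r..<k} + E k = sum E {\<kappa> r..<Suc k}"
          using k by simp
        also have "(1 / f r + 1 / f r) * sum E {\<kappa> r..<Suc k} \<le> (1 / f r + 1 / f r) * block r"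
          unfolding block_def using k pos E by (intro mult_left_mono sum_mono2) auto
        finally show ?thesis using pos by (simp add: field_simps)
      qed
    qed
  qed

  \<comment> \<open>The block estimate holds from some \<open>r\<close> on that depends on \<open>i\<close>, so only finitely many \<open>i\<close> are
    treated at once, and the choice of \<open>r\<close> is then made diagonally.\<close>
  have "\<exists>r>N. (\<Sum>i=1..N. (infdist (x (\<kappa> r)) (C i))\<^sup>2) < inverse (real (Suc N))" for N
  proof (rule frequently_small_if_weighted_sums_bounded[OF f_diverges])
    show "0 \<le> f r" if "r \<ge> 1" for r using f_range[OF that] by simp
    show "0 \<le> real N * (2 * block r)" for r by (simp add: block_def sum_nonneg E)
    show "(\<Sum>r=1..n. real N * (2 * block r)) \<le> real N * (2 * B)" for n
      using block_bounded[of n] by (simp add: mult_left_mono flip: sum_distrib_left)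
    have "\<forall>\<^sub>F r in sequentially. \<forall>i\<in>{1..N}. f r * (infdist (x (\<kappa> r)) (C i))\<^sup>2 \<le> 2 * block r"
      using block_estimate by (intro eventually_ball_finite) auto
    then show "\<forall>\<^sub>F r in sequentially.
        f r * (\<Sum>i=1..N. (infdist (x (\<kappa> r)) (C i))\<^sup>2) \<le> real N * (2 * block r)"
    proof eventually_elim
      case (elim r)
      then show ?case
        using sum_bounded_above[of "{1..N}" "\<lambda>i. f r * (infdist (x (\<kappa> r)) (C i))\<^sup>2" "2 * block r"]
        by (simp add: sum_distrib_left)
    qed
  qed simp
  then obtain \<rho> where \<rho>:
    "\<And>N. (\<Sum>i=1..N. (infdist (x (\<kappa> (\<rho> N))) (C i))\<^sup>2) < inverse (real (Suc N))"
    by metis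
  have infdist_tendsto: "(\<lambda>N. (infdist (x (\<kappa> (\<rho> N))) (C i))\<^sup>2) \<longlonglongrightarrow> 0" if i: "i \<ge> 1" for i
  proof (rule tendsto_sandwich[OF _ _ tendsto_const LIMSEQ_inverse_real_of_nat])
    show "\<forall>\<^sub>F N in sequentially. (infdist (x (\<kappa> (\<rho> N))) (C i))\<^sup>2 \<le> inverse (real (Suc N))"
      using eventually_ge_at_top[of i]
    proof eventually_elim
      case (elim N)
      have "(infdist (x (\<kappa> (\<rho> N))) (C i))\<^sup>2 \<le> (\<Sum>i=1..N. (infdist (x (\<kappa> (\<rho> N))) (C i))\<^sup>2)"
        using i elim by (intro member_le_sum) auto
      then show ?case using \<rho>[of N] by linarith
    qed
  qed simp
  show ?thesis
  proof (rule fejer_monotone_convergent[where \<sigma> = "\<lambda>N. \<kappa> (\<rho> N)"])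
    show "dist (x (Suc k)) p \<le> dist (x k) p" if "p \<in> (\<Inter>i\<in>{1..}. C i)" for p k
    proof (rule power2_le_imp_le)
      show "(dist (x (Suc k)) p)\<^sup>2 \<le> (dist (x k) p)\<^sup>2"
        using pythagoras[OF that, of k] E[of k] by linarith
    qed simp
    show "(\<Inter>i\<in>{1..}. C i) \<noteq> {}" by (rule Inter_C)
    fix s :: "nat \<Rightarrow> nat" and p
    assume s: "strict_mono s" and lim: "(x \<circ> ((\<lambda>N. \<kappa> (\<rho> N)) \<circ> s)) \<longlonglongrightarrow> p"
    show "p \<in> (\<Inter>i\<in>{1..}. C i)"
    proof
      fix i :: nat assume "i \<in> {1..}"
      then have i: "i \<ge> 1" by simp
      have "(\<lambda>n. (infdist (x (\<kappa> (\<rho> (s n)))) (C i))\<^sup>2) \<longlonglongrightarrow> (infdist p (C i))\<^sup>2"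
        using lim by (intro tendsto_intros) (simp add: comp_def)
      moreover have "(\<lambda>n. (infdist (x (\<kappa> (\<rho> (s n)))) (C i))\<^sup>2) \<longlonglongrightarrow> 0"
        using LIMSEQ_subseq_LIMSEQ[OF infdist_tendsto[OF i] s] by (simp add: comp_def)
      ultimately have "infdist p (C i) = 0"
        using LIMSEQ_unique by fastforce
      then show "p \<in> C i"
        using closed_C[OF i] nonempty[OF i] by (simp add: in_closed_iff_infdist_zero)
    qed
  qed
qed

end
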